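(* Consider the optimisation problem in the variables $(a,u,v,u_K,v_{KK},w_\tau,s_{\mathrm{lo}},s_{\mathrm{hi}})\in\mathbb{R}^P\times\mathbb{R}^N\times\mathbb{R}^N\times(\mathbb{R}^G)^5$: minimise $$ \begin{aligned} &\tfrac12\|W^{1/2}(A^{q}a-y)\|_2^2+\tfrac{\mu}{2}(\|u\|_2^2+\|v\|_2^2)+\tfrac{\lambda_{\mathrm{ridge}}}{2}a^\top\Lambda a+\tfrac{\lambda_{\mathrm{DW}}}{2}a^\top E^\top L^{+}Ea+\tfrac{\eta_{\mathrm{RN}}}{2}(A_{\tau|K}a)^\top\Pi_{0^+}(A_{\tau|K}a)\\ &+\tfrac{\lambda_\Omega}{2}a^\top U_\omega^\top M_\omega^\top M_\omega U_\omega a+\tfrac{\lambda_{\mathrm{hook}}}{2}\|CAa\|_2^2+\tfrac{\lambda_{\mathrm{RN}}}{2}(Aa-C_{0^+})^\top\Pi_{0^+}(Aa-C_{0^+})\\ &+\tfrac{\lambda_{\mathrm{NA}}}{2}(\|u_K\|_2^2+\|v_{KK}\|_2^2+\|w_\tau\|_2^2)+\tfrac{\lambda_{\mathrm{B}}}{2}(\|s_{\mathrm{lo}}\|_2^2+\|s_{\mathrm{hi}}\|_2^2) \end{aligned} $$ subject to the componentwise constraints $u\ge p^{\mathrm{bid}}-A^{q}a$, $v\ge A^{q}a-p^{\mathrm{ask}}$, $u_K\ge A_Ka$, $v_{KK}\ge -A_{KK}a$, $w_\tau\ge -A_{\tau|K}a$, $s_{\mathrm{lo}}\ge -Aa$,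 $s_{\mathrm{hi}}\ge Aa-F$, and $u,v,u_K,v_{KK},w_\tau,s_{\mathrm{lo}},s_{\mathrm{hi}}\ge 0$, where all weights $\mu,\lambda_\bullet,\eta_{\mathrm{RN}}$ are nonnegative. Then this program is convex. Moreover, if a feasible primal–dual point satisfies the KKT conditions of this program, then its primal part (with associated coefficient vector $a^\star$) is a global minimiser.
   Context: Coefficients $a=(a_{k\ell})_{0\le k\le K_0,\,0\le\ell\le L_0}\in\mathbb{R}^P$, $P=(K_0+1)(L_0+1)$, parametrise a surface $C_a(m,\tau)=\sum_{k,\ell}a_{k\ell}T_k(\Phi_m(m))T_\ell(\Phi_\tau(\tau))$, where $T_k$ are Chebyshev polynomials of the first kind and $\Phi_m,\Phi_\tau$ are fixed smooth coordinate maps into $[-1,1]$. All the following are fixed (independent of $a$). Quotes: $A^{q}\in\mathbb{R}^{N\times P}$ maps $a$ to the values of $C_a$ at $N$ quote points; $p^{\mathrm{bid}}\le p^{\mathrm{ask}}$ in $\mathbb{R}^N$ are bid and ask vectors, $y=\tfrac12(p^{\mathrm{bid}}+p^{\mathrm{ask}})$; $W=\mathrm{diag}(w_1,\dots,w_N)$ with $w_i>0$. Grid: on grid points $(m_g,\tau_g)$, $g=1,\dots,G$, with forwards $F=(F_g)$, $F_g>0$, and strikes $K_g=F_ge^{m_g}$, the matrices $A,A_m,A_{mm},A_\tau\in\mathbb{R}^{G\times P}$ map $a$ to the grid values of $C_a,\partial_mC_a,\partial_{mm}C_a,\partial_\tau C_a$; $A_K=\mathrm{diag}(K_g)^{-1}A_m$,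 $A_{KK}=\mathrm{diag}(K_g)^{-2}(A_{mm}-A_m)$, $A_{\tau|K}=A_\tau-\mathrm{diag}(\rho(\tau_g))A_m$ with $\rho=\frac{d}{d\tau}\log F$. Regularisers: $\Lambda\in\mathbb{R}^{P\times P}$ is diagonal with entries $(1+\alpha k^2+\beta\ell^2)^s$, $\alpha,\beta,s>0$; $E$ is $A_{KK}$ with rows reordered by maturity slice; $L^{+}$ is a symmetric positive semidefinite matrix (pseudoinverse of a block-diagonal discrete Neumann Laplacian); $U_\omega\in\mathbb{R}^{P\times P}$ is orthogonal; $M_\omega\in\mathbb{R}^{P\times P}$ is a diagonal mask; $C=\widetilde A_{\tau|K}\widetilde A_K-\widetilde A_K\widetilde A_{\tau|K}$ for fixed $\widetilde A_K,\widetilde A_{\tau|K}\in\mathbb{R}^{G\times G}$; $\Pi_{0^+}\in\mathbb{R}^{G\times G}$ is the diagonal $0/1$ selector of grid points with $\tau_g\le\tau_\star$; $C_{0^+}\in\mathbb{R}^G$ is a fixed vector. *)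

theory Defs
  imports "HOL-Analysis.Analysis"
begin

section \<open>Chebyshev surfaces\<close>

fun cheb_T :: "nat \<Rightarrow> real \<Rightarrow> real" where
  "cheb_T 0 x = 1"
| "cheb_T (Suc 0) x = x"
| "cheb_T (Suc (Suc n)) x = 2 * x * cheb_T (Suc n) x - cheb_T n x"

text \<open>Derivatives are taken within \<open>S\<close>, hence are one-sided at an endpoint contained in \<open>S\<close>.\<close>

definition smooth_within :: "real set \<Rightarrow> (real \<Rightarrow> real) \<Rightarrow> bool" where
  "smooth_within S f \<longleftrightarrow>
     (\<exists>D :: nat \<Rightarrow> real \<Rightarrow> real. (\<forall>x\<in>S. D 0 x = f x) \<and>
        (\<forall>n. \<forall>x\<in>S. (D n has_real_derivative D (Suc n) x) (at x within S)))"

text \<open>A coordinate map from a nondegenerate (possibly unbounded) interval \<open>S\<close> into \<open>[-1,1]\<close>.\<close>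

definition coordinate_map :: "real set \<Rightarrow> (real \<Rightarrow> real) \<Rightarrow> bool" where
  "coordinate_map S \<Phi> \<longleftrightarrow>
     is_interval S \<and> interior S \<noteq> {} \<and> smooth_within S \<Phi> \<and> \<Phi> ` S \<subseteq> {-1..1}"

text \<open>The coefficient with double index \<open>(k, l)\<close> is the entry \<open>a $ pos k l\<close> of the
  coefficient vector; \<open>pos\<close> is a bijective flattening of the index rectangle.\<close>

definition coeff_indexing :: "nat \<Rightarrow> nat \<Rightarrow> (nat \<Rightarrow> nat \<Rightarrow> 'p::finite) \<Rightarrow> bool" where
  "coeff_indexing K0 L0 pos \<longleftrightarrow> bij_betw (\<lambda>(k, l). pos k l) ({0..K0} \<times> {0..L0}) UNIV"

definition surface ::
  "nat \<Rightarrow> nat \<Rightarrow> (nat \<Rightarrow> nat \<Rightarrow> 'p::finite) \<Rightarrow> (real \<Rightarrow> real) \<Rightarrow> (real \<Rightarrow> real) \<Rightarrow>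
   real ^ 'p \<Rightarrow> real \<Rightarrow> real \<Rightarrow> real" where
  "surface K0 L0 pos \<Phi>m \<Phi>\<tau> a m \<tau> =
     (\<Sum>k=0..K0. \<Sum>l=0..L0. a $ pos k l * cheb_T k (\<Phi>m m) * cheb_T l (\<Phi>\<tau> \<tau>))"

text \<open>Partial derivatives of a function on a rectangle with sides \<open>S\<close> (first variable) and
  \<open>T\<close> (second variable).\<close>

definition partial_1 :: "real set \<Rightarrow> (real \<Rightarrow> real \<Rightarrow> real) \<Rightarrow> real \<Rightarrow> real \<Rightarrow> real" where
  "partial_1 S f x t = vector_derivative (\<lambda>x'. f x' t) (at x within S)"

definition partial_2 :: "real set \<Rightarrow> (real \<Rightarrow> real \<Rightarrow> real) \<Rightarrow> real \<Rightarrow> real \<Rightarrow> real" where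
  "partial_2 T f x t = vector_derivative (\<lambda>t'. f x t') (at t within T)"

section \<open>Matrices\<close>

definition diag :: "real ^ 'n \<Rightarrow> real ^ 'n ^ 'n" where
  "diag d = (\<chi> i j. if i = j then d $ i else 0)"

definition sym_psd :: "real ^ 'n ^ 'n \<Rightarrow> bool" where
  "sym_psd M \<longleftrightarrow> transpose M = M \<and> (\<forall>z. 0 \<le> z \<bullet> (M *v z))"

section \<open>Inequality-constrained programs and KKT points\<close>

text \<open>The program is: minimise \<open>f x\<close> subject to \<open>c x \<le> 0\<close>.  The order on an ordered Euclidean
  space is componentwise, so \<open>c\<close> collects finitely many scalar constraints \<open>c x \<bullet> b \<le> 0\<close>,
  one for each \<open>b \<in> Basis\<close>, with multiplier \<open>l \<bullet> b\<close>.\<close>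

definition feasible ::
  "('v::euclidean_space \<Rightarrow> 'd::ordered_euclidean_space) \<Rightarrow> 'v \<Rightarrow> bool" where
  "feasible c x \<longleftrightarrow> c x \<le> 0"

definition convex_program ::
  "('v::euclidean_space \<Rightarrow> real) \<Rightarrow> ('v \<Rightarrow> 'd::ordered_euclidean_space) \<Rightarrow> bool" where
  "convex_program f c \<longleftrightarrow>
     convex_on UNIV f \<and> (\<forall>b\<in>Basis. convex_on UNIV (\<lambda>x. c x \<bullet> b))"

definition lagrangian ::
  "('v::euclidean_space \<Rightarrow> real) \<Rightarrow> ('v \<Rightarrow> 'd::ordered_euclidean_space) \<Rightarrow> 'v \<Rightarrow> 'd \<Rightarrow> real" where
  "lagrangian f c x l = f x + l \<bullet> c x"

text \<open>The conjuncts are primal feasibility, dual feasibility, complementary slackness and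
  stationarity.\<close>

definition kkt_point ::
  "('v::euclidean_space \<Rightarrow> real) \<Rightarrow> ('v \<Rightarrow> 'd::ordered_euclidean_space) \<Rightarrow> 'v \<Rightarrow> 'd \<Rightarrow> bool" where
  "kkt_point f c x l \<longleftrightarrow>
     feasible c x \<and> 0 \<le> l \<and> (\<forall>b\<in>Basis. (l \<bullet> b) * (c x \<bullet> b) = 0) \<and>
     ((\<lambda>z. lagrangian f c z l) has_derivative (\<lambda>h. 0)) (at x)"

end

theory Submission
  imports Defs
begin

text \<open>Every summand of the objective is a nonnegative multiple of a positive semidefinite quadratic
  form composed with an affine map, hence convex, and the constraint map is affine.  At a KKT point
  the Lagrangian is therefore a convex function with vanishing derivative, so it is minimal there;
  on the feasible set the Lagrangian is at most the objective, with equality at the KKT point by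
  complementary slackness.\<close>

text \<open>Restricting \<open>f\<close> to the line through \<open>x\<close> and \<open>y\<close>
  reduces the claim to one real variable, where a convex function lies above its tangents. By the
  chain rule the tangent at the parameter of \<open>x\<close> is horizontal.\<close>

lemma convex_on_stationary_imp_min:
  fixes f :: "'v::real_normed_vector \<Rightarrow> real"
  assumes cvx: "convex_on UNIV f" and der: "(f has_derivative (\<lambda>h. 0)) (at x)"
  shows "f x \<le> f y"
proof -
  define \<gamma> where "\<gamma> = (\<lambda>t::real. x + t *\<^sub>R (y - x))"
  have "convex_on UNIV (f \<circ> \<gamma>)"
  proof (rule convex_onI)
    fix t s r :: real
    assume "0 < t" "t < 1"
    moreover have "\<gamma> ((1 - t) *\<^sub>R s + t *\<^sub>R r) = (1 - t) *\<^sub>R \<gamma> s + t *\<^sub>R \<gamma> r"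
      by (simp add: \<gamma>_def algebra_simps)
    ultimately show "(f \<circ> \<gamma>) ((1 - t) *\<^sub>R s + t *\<^sub>R r) \<le> (1 - t) * (f \<circ> \<gamma>) s + t * (f \<circ> \<gamma>) r"
      using convex_onD[OF cvx, of t "\<gamma> s" "\<gamma> r"] by simp
  qed simp
  moreover have "(f \<circ> \<gamma> has_real_derivative 0) (at 0)"
  proof -
    have "(\<gamma> has_derivative (\<lambda>t. t *\<^sub>R (y - x))) (at 0)"
      unfolding \<gamma>_def by (auto intro!: derivative_eq_intros)
    moreover have "(f has_derivative (\<lambda>h. 0)) (at (\<gamma> 0))"
      using der by (simp add: \<gamma>_def)
    ultimately have "(f \<circ> \<gamma> has_derivative (\<lambda>h. 0) \<circ> (\<lambda>t. t *\<^sub>R (y - x))) (at 0)"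
      by (rule diff_chain_at)
    then show ?thesis
      by (simp add: has_field_derivative_def o_def lambda_zero)
  qed
  ultimately have "(f \<circ> \<gamma>) 1 - (f \<circ> \<gamma>) 0 \<ge> 0 * (1 - 0)"
    using convex_on_imp_above_tangent[of UNIV "f \<circ> \<gamma>" 0 1 0] by simp
  then show ?thesis
    by (simp add: \<gamma>_def)
qed

theorem convex_program_kkt_imp_arg_min:
  fixes f :: "'v::euclidean_space \<Rightarrow> real"
    and c :: "'v \<Rightarrow> 'd::ordered_euclidean_space"
  assumes cp: "convex_program f c" and kkt: "kkt_point f c x l"
  shows "is_arg_min f (feasible c) x"
proof -
  have feas: "feasible c x" and l: "0 \<le> l"
    and slack: "\<And>b. b \<in> Basis \<Longrightarrow> (l \<bullet> b) * (c x \<bullet> b) = 0"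
    and stat: "((\<lambda>z. lagrangian f c z l) has_derivative (\<lambda>h. 0)) (at x)"
    using kkt by (auto simp: kkt_point_def)
  \<comment> \<open>The sign of the multipliers enters twice: it keeps the Lagrangian convex, and it
    makes the multiplier term nonpositive at feasible points.\<close>
  have l_nonneg: "0 \<le> l \<bullet> b" if "b \<in> Basis" for b
    using l that by (simp add: eucl_le[of 0 l])
  have lag: "lagrangian f c z l = f z + (\<Sum>b\<in>Basis. (l \<bullet> b) * (c z \<bullet> b))" for z
    unfolding lagrangian_def by (subst euclidean_inner) simp
  have "convex_on UNIV (\<lambda>z. lagrangian f c z l)"
  proof -
    \<comment> \<open>\<open>Basis\<close> is generalised to a finite subset \<open>B\<close>, so
      that induction builds the sum from binary additions while every inserted \<open>b\<close> is
      still a basis vector with a nonnegative multiplier.\<close>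
    have "convex_on UNIV (\<lambda>z. \<Sum>b\<in>B. (l \<bullet> b) * (c z \<bullet> b))"
      if "finite B" "B \<subseteq> Basis" for B
      using that cp l_nonneg
      by (induction B rule: finite_induct)
        (auto simp: convex_program_def convex_on_const intro!: convex_on_add convex_on_cmul)
    then show ?thesis
      unfolding lag using cp by (simp add: convex_program_def convex_on_add)
  qed
  then have min: "lagrangian f c x l \<le> lagrangian f c z l" for z
    using stat by (rule convex_on_stationary_imp_min)
  have "f x \<le> f z" if "feasible c z" for z
  proof -
    have "(\<Sum>b\<in>Basis. (l \<bullet> b) * (c z \<bullet> b)) \<le> 0"
      using that l_nonneg
      by (intro sum_nonpos mult_nonneg_nonpos) (auto simp: feasible_def eucl_le[of "c z" 0])
    \<comment> \<open>Complementary slackness removes each summand separately.\<close>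
    moreover have "lagrangian f c x l = f x"
      unfolding lag by (simp only: slack sum.neutral_const add_0_right cong: sum.cong)
    ultimately show ?thesis
      using min[of z] by (simp add: lag)
  qed
  then show ?thesis
    using feas by (auto simp: is_arg_min_def not_less)
qed

text \<open>Stated by affine combinations of two points rather than as a linear map plus a constant:
  this is the form that is substituted into the convexity inequality, and it yields syntactic
  closure rules.\<close>

definition affine_map :: "('a::real_vector \<Rightarrow> 'b::real_vector) \<Rightarrow> bool" where
  "affine_map f \<longleftrightarrow> (\<forall>x y t. f ((1 - t) *\<^sub>R x + t *\<^sub>R y) = (1 - t) *\<^sub>R f x + t *\<^sub>R f y)"

lemma affine_map_id: "affine_map (\<lambda>x. x)"
  by (simp add: affine_map_def)

lemma affine_map_const: "affine_map (\<lambda>x. k)"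
  by (simp add: affine_map_def flip: scaleR_left_distrib)

lemma affine_map_compose_linear: "linear g \<Longrightarrow> affine_map f \<Longrightarrow> affine_map (\<lambda>x. g (f x))"
  by (simp add: affine_map_def linear_add linear_scale)

lemmas affine_map_fst = affine_map_compose_linear[OF linear_fst]
lemmas affine_map_snd = affine_map_compose_linear[OF linear_snd]
lemmas affine_map_matrix = affine_map_compose_linear[OF matrix_vector_mul_linear]
lemmas affine_map_minus = affine_map_compose_linear[OF linear_uminus]

lemma affine_map_diff: "affine_map f \<Longrightarrow> affine_map g \<Longrightarrow> affine_map (\<lambda>x. f x - g x)"
  by (simp add: affine_map_def algebra_simps)

lemma affine_map_Pair: "affine_map f \<Longrightarrow> affine_map g \<Longrightarrow> affine_map (\<lambda>x. (f x, g x))"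
  by (simp add: affine_map_def)

lemmas affine_map_intros =
  affine_map_id affine_map_const affine_map_fst affine_map_snd affine_map_matrix
  affine_map_minus affine_map_diff affine_map_Pair

lemma convex_on_affine_inner:
  fixes f :: "'a::real_vector \<Rightarrow> 'b::real_inner"
  assumes "affine_map f"
  shows "convex_on UNIV (\<lambda>x. f x \<bullet> b)"
  using assms by (intro convex_onI) (simp_all add: affine_map_def inner_simps)

text \<open>With \<open>q z = z \<bullet> g z\<close>, the gap in the convexity inequality between
  points \<open>p\<close> and \<open>r\<close> is exactly \<open>t * (1 - t) * q (p - r)\<close>,
  which is nonnegative.\<close>

lemma convex_on_quadratic_form:
  fixes f :: "'a::real_vector \<Rightarrow> 'b::real_inner"
  assumes g: "linear g" and nonneg: "\<And>z. 0 \<le> z \<bullet> g z" and f: "affine_map f"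
  shows "convex_on UNIV (\<lambda>x. f x \<bullet> g (f x))"
proof (rule convex_onI)
  fix t :: real and x y :: 'a
  assume t: "0 < t" "t < 1"
  have f_comb: "f ((1 - t) *\<^sub>R x + t *\<^sub>R y) = (1 - t) *\<^sub>R f x + t *\<^sub>R f y"
    using f unfolding affine_map_def by blast
  have "f ((1 - t) *\<^sub>R x + t *\<^sub>R y) \<bullet> g (f ((1 - t) *\<^sub>R x + t *\<^sub>R y))
      = (1 - t) * (f x \<bullet> g (f x)) + t * (f y \<bullet> g (f y))
        - t * (1 - t) * ((f x - f y) \<bullet> g (f x - f y))"
    \<comment> \<open>Bilinear expansion leaves a polynomial identity in \<open>t\<close> and the
      four inner products of \<open>f x\<close>, \<open>f y\<close> with their images under
      \<open>g\<close>.\<close>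
    unfolding f_comb linear_add[OF g] linear_diff[OF g] linear_scale[OF g] inner_add_left
        inner_add_right inner_diff_left inner_diff_right inner_scaleR_left inner_scaleR_right
    by (simp add: algebra_simps)
  moreover have "0 \<le> t * (1 - t) * ((f x - f y) \<bullet> g (f x - f y))"
    using t nonneg by simp
  ultimately show "f ((1 - t) *\<^sub>R x + t *\<^sub>R y) \<bullet> g (f ((1 - t) *\<^sub>R x + t *\<^sub>R y))
      \<le> (1 - t) * (f x \<bullet> g (f x)) + t * (f y \<bullet> g (f y))"
    by simp
qed simp

lemma convex_on_matrix_form:
  fixes f :: "'a::real_vector \<Rightarrow> real ^ 'n"
  assumes "\<And>z. 0 \<le> z \<bullet> (M *v z)" and "affine_map f"
  shows "convex_on UNIV (\<lambda>x. f x \<bullet> (M *v f x))"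
  using assms by (intro convex_on_quadratic_form) auto

lemma convex_on_norm_squared:
  fixes f :: "'a::real_vector \<Rightarrow> 'b::real_inner"
  assumes "affine_map f"
  shows "convex_on UNIV (\<lambda>x. (norm (f x))\<^sup>2)"
  unfolding power2_norm_eq_inner
  by (rule convex_on_quadratic_form[of "\<lambda>z. z"]) (simp_all add: assms linear_id[unfolded id_def])

text \<open>The form of a diagonal matrix is a weighted sum of squares.\<close>

lemma inner_diag_nonneg:
  assumes "\<And>i. 0 \<le> d $ i"
  shows "0 \<le> z \<bullet> (diag d *v z)"
proof -
  have "z \<bullet> (diag d *v z) = (\<Sum>i\<in>UNIV. d $ i * (z $ i)\<^sup>2)"
    by (simp add: inner_vec_def matrix_vector_mult_def diag_def if_distrib if_distribR sum.delta
        power2_eq_square algebra_simps cong: if_cong)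
  then show ?thesis
    using assms by (simp add: sum_nonneg)
qed

text \<open>Moving \<open>transpose B\<close> across the inner product turns it into
  \<open>B\<close>. Nonnegativity of the form of \<open>M\<close> thus passes to the congruent
  matrix.\<close>

lemma inner_congruence:
  fixes B :: "real ^ 'p ^ 'g" and M :: "real ^ 'g ^ 'g"
  shows "z \<bullet> ((transpose B ** M ** B) *v z) = (B *v z) \<bullet> (M *v (B *v z))"
proof -
  have "z \<bullet> ((transpose B ** M ** B) *v z) = z \<bullet> (transpose B *v (M *v (B *v z)))"
    by (simp only: matrix_vector_mul_assoc matrix_mul_assoc)
  also have "\<dots> = (z v* transpose B) \<bullet> (M *v (B *v z))"
    by (simp only: dot_lmul_matrix)
  finally show ?thesis
    by (simp only: vector_transpose_matrix)
qed

theorem proposition7: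
  fixes K0 L0 :: nat
    and pos :: "nat \<Rightarrow> nat \<Rightarrow> 'p::finite"
    and Dm D\<tau> :: "real set"
    and \<Phi>m \<Phi>\<tau> :: "real \<Rightarrow> real"
    and C :: "real ^ 'p \<Rightarrow> real \<Rightarrow> real \<Rightarrow> real"
    and mq \<tau>q :: "'n::finite \<Rightarrow> real"
    and Aq :: "real ^ 'p ^ 'n"
    and pbid pask y w :: "real ^ 'n"
    and m \<tau> :: "'g::finite \<Rightarrow> real"
    and fwd \<rho> :: "real \<Rightarrow> real"
    and F K :: "real ^ 'g"
    and A Am Amm A\<tau> AK AKK A\<tau>K :: "real ^ 'p ^ 'g"
    and \<alpha> \<beta> s :: real
    and \<Lambda>d mask :: "real ^ 'p"
    and \<Lambda> U\<omega> M\<omega> :: "real ^ 'p ^ 'p"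
    and num :: "'g \<Rightarrow> nat" and \<sigma> :: "'g \<Rightarrow> 'g"
    and E :: "real ^ 'p ^ 'g"
    and Lp AKt A\<tau>Kt Hook \<Pi>0 :: "real ^ 'g ^ 'g"
    and \<tau>star :: real
    and C0 :: "real ^ 'g"
    and \<mu> lam_ridge lam_DW \<eta>RN lam_\<Omega> lam_hook lam_RN lam_NA lam_B :: real
    and J :: "(real ^ 'p) \<times> (real ^ 'n) \<times> (real ^ 'n) \<times>
              (real ^ 'g) \<times> (real ^ 'g) \<times> (real ^ 'g) \<times> (real ^ 'g) \<times> (real ^ 'g) \<Rightarrow> real"
    and c :: "(real ^ 'p) \<times> (real ^ 'n) \<times> (real ^ 'n) \<times>
              (real ^ 'g) \<times> (real ^ 'g) \<times> (real ^ 'g) \<times> (real ^ 'g) \<times> (real ^ 'g) \<Rightarrow>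
              (real ^ 'n) \<times> (real ^ 'n) \<times>
              (real ^ 'g) \<times> (real ^ 'g) \<times> (real ^ 'g) \<times> (real ^ 'g) \<times> (real ^ 'g) \<times>
              (real ^ 'n) \<times> (real ^ 'n) \<times>
              (real ^ 'g) \<times> (real ^ 'g) \<times> (real ^ 'g) \<times> (real ^ 'g) \<times> (real ^ 'g)"
  assumes pos: "coeff_indexing K0 L0 pos"
    and \<Phi>m: "coordinate_map Dm \<Phi>m"
    and \<Phi>\<tau>: "coordinate_map D\<tau> \<Phi>\<tau>"
    and C: "C = surface K0 L0 pos \<Phi>m \<Phi>\<tau>"
    \<comment> \<open>quotes\<close>
    and quote_points: "\<And>i. mq i \<in> Dm \<and> \<tau>q i \<in> D\<tau>"
    and Aq: "\<And>a. Aq *v a = (\<chi> i. C a (mq i) (\<tau>q i))"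
    and bid_ask: "pbid \<le> pask"
    and y: "y = (1/2) *\<^sub>R (pbid + pask)"
    and w: "\<And>i. w $ i > 0"
    \<comment> \<open>grid\<close>
    and grid_points: "\<And>g. m g \<in> Dm \<and> \<tau> g \<in> D\<tau>"
    and fwd_pos: "\<And>t. t \<in> D\<tau> \<Longrightarrow> fwd t > 0"
    and fwd_diff: "(\<lambda>t. ln (fwd t)) differentiable_on D\<tau>"
    and \<rho>: "\<And>t. t \<in> D\<tau> \<Longrightarrow> \<rho> t = vector_derivative (\<lambda>t. ln (fwd t)) (at t within D\<tau>)"
    and F: "F = (\<chi> g. fwd (\<tau> g))"
    and K: "K = (\<chi> g. F $ g * exp (m g))"
    and A: "\<And>a. A *v a = (\<chi> g. C a (m g) (\<tau> g))"
    and Am: "\<And>a. Am *v a = (\<chi> g. partial_1 Dm (C a) (m g) (\<tau> g))"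
    and Amm: "\<And>a. Amm *v a = (\<chi> g. partial_1 Dm (partial_1 Dm (C a)) (m g) (\<tau> g))"
    and A\<tau>: "\<And>a. A\<tau> *v a = (\<chi> g. partial_2 D\<tau> (C a) (m g) (\<tau> g))"
    and AK: "AK = matrix_inv (diag K) ** Am"
    and AKK: "AKK = (matrix_inv (diag K) ** matrix_inv (diag K)) ** (Amm - Am)"
    and A\<tau>K: "A\<tau>K = A\<tau> - diag (\<chi> g. \<rho> (\<tau> g)) ** Am"
    \<comment> \<open>regularisers\<close>
    and \<alpha>\<beta>s: "\<alpha> > 0" "\<beta> > 0" "s > 0"
    and \<Lambda>d: "\<And>k l. k \<le> K0 \<Longrightarrow> l \<le> L0 \<Longrightarrow>
                \<Lambda>d $ pos k l = (1 + \<alpha> * (real k)\<^sup>2 + \<beta> * (real l)\<^sup>2) powr s"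
    and \<Lambda>: "\<Lambda> = diag \<Lambda>d"
    \<comment> \<open>\<open>num\<close> numbers the rows; after permuting by \<open>\<sigma>\<close>, rows of equal maturity are consecutive\<close>
    and num: "bij_betw num UNIV {1..CARD('g)}"
    and slices: "bij \<sigma>"
      "\<And>i j k. num i \<le> num j \<Longrightarrow> num j \<le> num k \<Longrightarrow> \<tau> (\<sigma> i) = \<tau> (\<sigma> k) \<Longrightarrow> \<tau> (\<sigma> j) = \<tau> (\<sigma> i)"
    and E: "E = (\<chi> i. AKK $ \<sigma> i)"
    and Lp: "sym_psd Lp"
    and U\<omega>: "orthogonal_matrix U\<omega>"
    and M\<omega>: "M\<omega> = diag mask"
    and Hook: "Hook = A\<tau>Kt ** AKt - AKt ** A\<tau>Kt"
    and \<Pi>0: "\<Pi>0 = diag (\<chi> g. if \<tau> g \<le> \<tau>star then 1 else 0)"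
    \<comment> \<open>weights\<close>
    and weights: "\<mu> \<ge> 0" "lam_ridge \<ge> 0" "lam_DW \<ge> 0" "\<eta>RN \<ge> 0" "lam_\<Omega> \<ge> 0" "lam_hook \<ge> 0"
      "lam_RN \<ge> 0" "lam_NA \<ge> 0" "lam_B \<ge> 0"
    \<comment> \<open>objective\<close>
    and J: "J = (\<lambda>(a, u, v, uK, vKK, w\<tau>, slo, shi).
        1/2 * (norm (diag (\<chi> i. sqrt (w $ i)) *v (Aq *v a - y)))\<^sup>2
      + \<mu>/2 * ((norm u)\<^sup>2 + (norm v)\<^sup>2)
      + lam_ridge/2 * (a \<bullet> (\<Lambda> *v a))
      + lam_DW/2 * (a \<bullet> ((transpose E ** Lp ** E) *v a))
      + \<eta>RN/2 * ((A\<tau>K *v a) \<bullet> (\<Pi>0 *v (A\<tau>K *v a)))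
      + lam_\<Omega>/2 * (a \<bullet> ((transpose U\<omega> ** transpose M\<omega> ** M\<omega> ** U\<omega>) *v a))
      + lam_hook/2 * (norm (Hook *v (A *v a)))\<^sup>2
      + lam_RN/2 * ((A *v a - C0) \<bullet> (\<Pi>0 *v (A *v a - C0)))
      + lam_NA/2 * ((norm uK)\<^sup>2 + (norm vKK)\<^sup>2 + (norm w\<tau>)\<^sup>2)
      + lam_B/2 * ((norm slo)\<^sup>2 + (norm shi)\<^sup>2))"
    \<comment> \<open>constraints, in the form \<open>c x \<le> 0\<close>\<close>
    and c: "c = (\<lambda>(a, u, v, uK, vKK, w\<tau>, slo, shi).
       ((pbid - Aq *v a) - u,
        (Aq *v a - pask) - v,
        AK *v a - uK,
        - (AKK *v a) - vKK,
        - (A\<tau>K *v a) - w\<tau>,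
        - (A *v a) - slo,
        (A *v a - F) - shi,
        - u, - v, - uK, - vKK, - w\<tau>, - slo, - shi))"
  shows "convex_program J c \<and>
         (\<forall>z l. kkt_point J c z l \<longrightarrow> is_arg_min J (feasible c) z)"
proof -
  have \<Lambda>d_nonneg: "0 \<le> \<Lambda>d $ i" for i
  proof -
    \<comment> \<open>The entries of \<open>\<Lambda>d\<close> are prescribed only at positions
      \<open>pos k l\<close>; surjectivity of the flattening reaches every index, and values of
      \<open>powr\<close> are never negative.\<close>
    have "i \<in> (\<lambda>(k, l). pos k l) ` ({0..K0} \<times> {0..L0})"
      using pos by (simp add: coeff_indexing_def bij_betw_def)
    then show ?thesis
      using \<Lambda>d by auto
  qed
  have \<Lambda>_psd: "0 \<le> z \<bullet> (\<Lambda> *v z)" for z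
    unfolding \<Lambda> by (rule inner_diag_nonneg[OF \<Lambda>d_nonneg])
  have \<Pi>0_psd: "0 \<le> z \<bullet> (\<Pi>0 *v z)" for z
    unfolding \<Pi>0 by (rule inner_diag_nonneg) simp
  have DW_psd: "0 \<le> z \<bullet> ((transpose E ** Lp ** E) *v z)" for z
    using Lp by (simp add: inner_congruence sym_psd_def)
  have \<Omega>_psd: "0 \<le> z \<bullet> ((transpose U\<omega> ** transpose M\<omega> ** M\<omega> ** U\<omega>) *v z)" for z
    \<comment> \<open>The fourfold product is the congruence of the identity by
      \<open>M\<omega> ** U\<omega>\<close>, so its form is the squared length of
      \<open>(M\<omega> ** U\<omega>) *v z\<close>.\<close>
    using inner_congruence[of z "M\<omega> ** U\<omega>" "mat 1"]
    by (simp add: matrix_transpose_mul matrix_mul_assoc)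
  have "convex_on UNIV J"
    \<comment> \<open>Replacing the tuple pattern by projections makes each block of variables a
      linear image of the whole point, so the affine closure rules apply to the argument of every
      quadratic term.\<close>
    unfolding J case_prod_unfold using weights
    by (intro convex_on_add convex_on_cmul convex_on_norm_squared
        convex_on_matrix_form[OF \<Lambda>_psd] convex_on_matrix_form[OF \<Pi>0_psd]
        convex_on_matrix_form[OF DW_psd] convex_on_matrix_form[OF \<Omega>_psd] affine_map_intros) auto
  moreover have "affine_map c"
    unfolding c case_prod_unfold by (intro affine_map_intros)
  \<comment> \<open>Each scalar constraint is a component of the affine map \<open>c\<close>, hence
    convex.\<close>
  ultimately have "convex_program J c"
    by (simp add: convex_program_def convex_on_affine_inner)
  then show ?thesis
    using convex_program_kkt_imp_arg_min by blast
qed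

end
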